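(* Let $\mu,L>0$ and $a\in(0,1]$, let $f:\mathbb{R}^d\to\mathbb{R}$ be continuously differentiable, attain its minimum $f^\ast$, and satisfy $f\in\mathrm{LS}^L$. Let $(\tilde x_k)_{k\in\mathbb{N}}$ be given by gradient descent $\tilde x_{k+1}=\tilde x_k-\gamma\nabla f(\tilde x_k)$ with $\gamma=\frac1L$. (i) If also $f\in\mathrm{PL}^\mu$, then for all $k\in\mathbb{N}$, $$f(\tilde x_k)-f^\ast\le\Big(1-\frac\mu L\Big)^k(f(\tilde x_0)-f^\ast).$$ (ii) If also $f$ has a unique global minimizer $x^\ast$ and $f\in\mathrm{PL}^\mu\cap\mathrm{AC}^a$, then for all $k\in\mathbb{N}$, $$f(\tilde x_k)-f^\ast\le K_0\Big(1-a\frac{\sqrt{\mu\mu_0}}{L}\Big)^k(f(\tilde x_0)-f^\ast),$$ with $K_0:=1+\sqrt{\frac{L_0}{\mu_0}}$, $\mu_0:=\sup\{\mu'\ge\mu:f\in\mathrm{QG}_-^{\mu'}\}$ and $L_0:=\inf\{L'\le L: f\in\mathrm{QG}_+^{L'}\}$.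
   Context: Function classes ($x^\ast$ is the global minimizer, $f^\ast=f(x^\ast)$): - $\mathrm{LS}^L$: $f(x)-f(y)-\langle\nabla f(y),x-y\rangle\le\frac L2\|x-y\|^2$ for all $x,y$. - $\mathrm{PL}^\mu$: $\|\nabla f(x)\|^2\ge2\mu(f(x)-f^\ast)$ for all $x$. - $\mathrm{AC}^a$: $\langle\nabla f(x),x-x^\ast\rangle\ge a\|\nabla f(x)\|\|x-x^\ast\|$ for all $x$. - $\mathrm{QG}_+^{L'}$ ($L'>0$): $f(x)-f^\ast\le\frac{L'}{2}\|x-x^\ast\|^2$ for all $x$. - $\mathrm{QG}_-^{\mu'}$ ($\mu'>0$): $f(x)-f^\ast\ge\frac{\mu'}{2}\|x-x^\ast\|^2$ for all $x$. Part (i) is a known result, recalled for comparison. *)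

theory Defs
  imports "HOL-Analysis.Analysis"
begin

definition gradient :: "('a::euclidean_space \<Rightarrow> real) \<Rightarrow> 'a \<Rightarrow> 'a" where
  "gradient f x = (THE D. GDERIV f x :> D)"

lemma GDERIV_gradient:
  assumes "f differentiable (at x)"
  shows "GDERIV f x :> gradient f x"
proof -
  obtain f' where f': "(f has_derivative f') (at x)"
    using assms unfolding differentiable_def by blast
  then have lin: "linear f'" by (rule has_derivative_linear)
  have "f' = (\<lambda>h. inner h (adjoint f' 1))"
    using adjoint_works[OF lin, of _ 1] by (auto simp: fun_eq_iff)
  with f' have D: "GDERIV f x :> adjoint f' 1"
    unfolding gderiv_def by simp
  show ?thesis
    unfolding gradient_def
  proof (rule theI[where P = "\<lambda>D. GDERIV f x :> D", OF D])
    fix D assume "GDERIV f x :> D"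
    then have "(\<lambda>h. inner h D) = (\<lambda>h. inner h (adjoint f' 1))"
      using D unfolding gderiv_def by (rule has_derivative_unique)
    then have "inner h D = inner h (adjoint f' 1)" for h
      by (rule fun_cong)
    then show "D = adjoint f' 1"
      by (metis vector_eq_ldot)
  qed
qed

lemma gradient_eqI: "GDERIV f x :> D \<Longrightarrow> gradient f x = D"
proof -
  assume D: "GDERIV f x :> D"
  then have "GDERIV f x :> gradient f x"
    by (intro GDERIV_gradient) (auto simp: gderiv_def differentiable_def)
  with D have "(\<lambda>h. inner h (gradient f x)) = (\<lambda>h. inner h D)"
    unfolding gderiv_def by (metis has_derivative_unique)
  then have "inner h (gradient f x) = inner h D" for h
    by (rule fun_cong)
  then show "gradient f x = D"
    by (metis vector_eq_ldot)
qed

definition continuously_differentiable :: "('a::euclidean_space \<Rightarrow> real) \<Rightarrow> bool" where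
  "continuously_differentiable f \<longleftrightarrow>
     (\<forall>x. f differentiable (at x)) \<and> continuous_on UNIV (gradient f)"

definition LS :: "real \<Rightarrow> ('a::euclidean_space \<Rightarrow> real) set" where
  "LS L = {f. \<forall>x y. f x - f y - inner (gradient f y) (x - y) \<le> L / 2 * (norm (x - y))\<^sup>2}"

text \<open>The classes below refer to the minimum value \<open>fstar\<close> or to the global minimizer
  \<open>xstar\<close> of the function; these are passed as explicit parameters.\<close>

definition PL :: "real \<Rightarrow> real \<Rightarrow> ('a::euclidean_space \<Rightarrow> real) set" where
  "PL fstar \<mu> = {f. \<forall>x. (norm (gradient f x))\<^sup>2 \<ge> 2 * \<mu> * (f x - fstar)}"

definition AC :: "'a::euclidean_space \<Rightarrow> real \<Rightarrow> ('a \<Rightarrow> real) set" where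
  "AC xstar a =
     {f. \<forall>x. inner (gradient f x) (x - xstar) \<ge> a * norm (gradient f x) * norm (x - xstar)}"

definition QG_plus :: "'a::euclidean_space \<Rightarrow> real \<Rightarrow> ('a \<Rightarrow> real) set" where
  "QG_plus xstar L' = {f. \<forall>x. f x - f xstar \<le> L' / 2 * (norm (x - xstar))\<^sup>2}"

definition QG_minus :: "'a::euclidean_space \<Rightarrow> real \<Rightarrow> ('a \<Rightarrow> real) set" where
  "QG_minus xstar \<mu>' = {f. \<forall>x. f x - f xstar \<ge> \<mu>' / 2 * (norm (x - xstar))\<^sup>2}"

text \<open>For \<open>\<mu> > 0\<close>, a continuously differentiable function in \<open>LS L\<close> and \<open>PL fstar \<mu>\<close>
  with unique minimizer \<open>xstar\<close> lies in \<open>QG_minus xstar \<mu>\<close> and \<open>QG_plus xstar L\<close>, and every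
  lower constant is at most every upper one. So both sets below are nonempty and bounded,
  and the real-valued \<open>Sup\<close> and \<open>Inf\<close> are the true supremum and infimum.\<close>

definition mu0 :: "('a::euclidean_space \<Rightarrow> real) \<Rightarrow> 'a \<Rightarrow> real \<Rightarrow> real" where
  "mu0 f xstar \<mu> = Sup {\<mu>'. 0 < \<mu>' \<and> \<mu> \<le> \<mu>' \<and> f \<in> QG_minus xstar \<mu>'}"

definition L0 :: "('a::euclidean_space \<Rightarrow> real) \<Rightarrow> 'a \<Rightarrow> real \<Rightarrow> real" where
  "L0 f xstar L = Inf {L'. 0 < L' \<and> L' \<le> L \<and> f \<in> QG_plus xstar L'}"

definition K0 :: "('a::euclidean_space \<Rightarrow> real) \<Rightarrow> 'a \<Rightarrow> real \<Rightarrow> real \<Rightarrow> real" where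
  "K0 f xstar \<mu> L = 1 + sqrt (L0 f xstar L / mu0 f xstar \<mu>)"

end

theory Submission
  imports Defs
begin

text \<open>Part (ii) rests on the Lyapunov function \<open>E\<^sub>k = (f x\<^sub>k - f\<^sup>*) + c * (norm (x\<^sub>k - x\<^sup>*))\<^sup>2\<close> with
  \<open>c = sqrt (\<mu>\<^sub>0 * L\<^sub>0) / 2\<close>. As \<open>c \<le> L / 2\<close>, the decrease of \<open>f\<close> absorbs the term
  \<open>c / L\<^sup>2 * (norm \<nabla>f)\<^sup>2\<close> arising from expanding the distance, so a step lowers \<open>E\<close> by at least
  \<open>2 * a * c / L * norm \<nabla>f * norm (x - x\<^sup>*)\<close>. Bounding \<open>norm \<nabla>f\<close> by \<open>PL\<close>, the two quadratic
  growth conditions bound this quantity below by both \<open>2 * r * (f x - f\<^sup>*)\<close> and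
  \<open>2 * r * c * (norm (x - x\<^sup>*))\<^sup>2\<close>, where \<open>r = a * sqrt (\<mu> * \<mu>\<^sub>0) / L\<close>; averaging gives the factor
  \<open>1 - r\<close>. The choice of \<open>c\<close> makes these two bounds balance and gives \<open>E\<^sub>0 \<le> K\<^sub>0 * (f x\<^sub>0 - f\<^sup>*)\<close>.\<close>

section \<open>Geometric decay and descent under \<open>LS\<close>\<close>

lemma continuously_differentiable_imp_continuous_on:
  assumes "continuously_differentiable f"
  shows "continuous_on S f"
  using assms unfolding continuously_differentiable_def
  by (meson continuous_at_imp_continuous_on differentiable_imp_continuous_within)

text \<open>A negative \<open>q\<close> forces \<open>u\<close> to vanish identically, so the factor
  \<open>1 - \<mu> / L\<close> can be used without first proving
  \<open>\<mu> \<le> L\<close>.\<close>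

lemma geometric_decay:
  fixes u :: "nat \<Rightarrow> real"
  assumes nonneg: "\<And>k. 0 \<le> u k" and step: "\<And>k. u (Suc k) \<le> q * u k"
  shows "u k \<le> q ^ k * u 0"
proof (cases "0 \<le> q")
  case True
  show ?thesis
  proof (induction k)
    case (Suc k)
    have "u (Suc k) \<le> q * u k" by (rule step)
    also have "\<dots> \<le> q * (q ^ k * u 0)" using Suc True by (rule mult_left_mono)
    finally show ?case by (simp add: mult.assoc)
  qed simp
next
  case False
  have "u k = 0" for k
    using nonneg[of k] nonneg[of "Suc k"] step[of k] False
    by (smt (verit) mult_neg_pos)
  then show ?thesis by simp
qed

lemma LS_descent:
  assumes "f \<in> LS L"
  shows "f (x - t *\<^sub>R gradient f x) \<le> f x - t * (1 - L * t / 2) * (norm (gradient f x))\<^sup>2"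
proof -
  have "f (x - t *\<^sub>R gradient f x) - f x - inner (gradient f x) (- (t *\<^sub>R gradient f x))
      \<le> L / 2 * (norm (t *\<^sub>R gradient f x))\<^sup>2"
    using assms unfolding LS_def
    by (smt (verit, best) mem_Collect_eq add_diff_cancel_left' diff_add_cancel minus_diff_eq norm_minus_cancel)
  then show ?thesis
    by (simp add: power2_norm_eq_inner[symmetric] power_mult_distrib algebra_simps power2_eq_square)
qed

lemma LS_descent_step:
  assumes "f \<in> LS L" and "0 < L"
  shows "f (x - (1 / L) *\<^sub>R gradient f x) \<le> f x - (norm (gradient f x))\<^sup>2 / (2 * L)"
  using LS_descent[OF assms(1), of x "1 / L"] assms(2) by (simp add: field_simps)

text \<open>A gradient step cannot improve on the minimizer, so the gradient vanishes at
  \<open>xs\<close>; there the \<open>LS\<close> inequality reduces to the growth bound.\<close>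

lemma LS_imp_QG_plus:
  assumes "f \<in> LS L" and "0 < L" and min: "\<And>x. f xs \<le> f x"
  shows "f \<in> QG_plus xs L"
proof -
  have "(norm (gradient f xs))\<^sup>2 / (2 * L) \<le> 0"
    using LS_descent_step[OF assms(1,2), of xs] min[of "xs - (1 / L) *\<^sub>R gradient f xs"] by linarith
  then have "gradient f xs = 0"
    using assms(2) by (simp add: divide_le_0_iff)
  moreover have "f x - f xs - inner (gradient f xs) (x - xs) \<le> L / 2 * (norm (x - xs))\<^sup>2" for x
    using assms(1) unfolding LS_def by blast
  ultimately show ?thesis
    unfolding QG_plus_def by simp
qed

section \<open>Quadratic growth from \<open>PL\<close>\<close>

text \<open>The point \<open>y\<close> below minimizes \<open>sqrt (f y - f xs) + \<lambda> * norm (y - x)\<close>, where \<open>\<lambda>\<close> is slightly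
  below the lower bound on the slope of \<open>sqrt (f - f xs)\<close> that \<open>PL\<close> provides away from \<open>xs\<close>. A
  gradient step would improve on it unless \<open>y = xs\<close>.\<close>

lemma PL_imp_growth:
  assumes cont: "continuous_on UNIV f" and "f \<in> LS L" and "0 < L" and "0 < \<mu>"
    and PL: "f \<in> PL (f xs) \<mu>"
    and min: "\<And>x. f xs \<le> f x" and uniq: "\<And>x. f x = f xs \<Longrightarrow> x = xs"
    and \<theta>: "0 < \<theta>" "\<theta> < 1"
  shows "\<theta> * (sqrt (2 * \<mu>) / 2 * norm (x - xs)) \<le> sqrt (f x - f xs)"
proof -
  define l where "l = \<theta> * (sqrt (2 * \<mu>) / 2)"
  define \<phi> where "\<phi> = (\<lambda>y. sqrt (f y - f xs) + l * norm (y - x))"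
  \<comment> \<open>Outside this ball the term \<open>l * norm (z - x)\<close> alone is at least
    \<open>\<phi> x\<close>, so a minimum over the compact ball is global.\<close>
  define R where "R = sqrt (f x - f xs) / l"
  have "0 < l" using \<theta> \<open>0 < \<mu>\<close> by (simp add: l_def)
  then have "0 \<le> R" using min[of x] by (simp add: R_def)
  have "continuous_on (cball x R) f"
    using cont by (rule continuous_on_subset) simp
  then have "continuous_on (cball x R) \<phi>"
    unfolding \<phi>_def by (intro continuous_intros)
  moreover have "cball x R \<noteq> {}" using \<open>0 \<le> R\<close> by simp
  ultimately obtain y where y: "\<And>z. z \<in> cball x R \<Longrightarrow> \<phi> y \<le> \<phi> z"
    using continuous_attains_inf[OF compact_cball] by metis
  have glob: "\<phi> y \<le> \<phi> z" for z
  proof (cases "z \<in> cball x R")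
    case False
    then have "R \<le> norm (z - x)"
      by (simp add: dist_norm norm_minus_commute)
    then have "l * R \<le> l * norm (z - x)"
      using \<open>0 < l\<close> by simp
    then have "sqrt (f x - f xs) \<le> \<phi> z"
      using min[of z] \<open>0 < l\<close> unfolding \<phi>_def R_def
      by (simp add: add_increasing)
    moreover have "\<phi> y \<le> \<phi> x" using y \<open>0 \<le> R\<close> by simp
    moreover have "\<phi> x = sqrt (f x - f xs)" by (simp add: \<phi>_def)
    ultimately show ?thesis by linarith
  qed (rule y)
  have "f y = f xs"
  proof (rule ccontr)
    assume "f y \<noteq> f xs"
    then have "f xs < f y" using min[of y] by linarith
    define s where "s = sqrt (f y - f xs)"
    define n where "n = norm (gradient f y)"
    have s: "0 < s" "s\<^sup>2 = f y - f xs" using \<open>f xs < f y\<close> by (simp_all add: s_def)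
    have "2 * \<mu> * s\<^sup>2 \<le> n\<^sup>2"
      using PL unfolding s(2) n_def PL_def by blast
    then have "(sqrt (2 * \<mu>) * s)\<^sup>2 \<le> n\<^sup>2"
      using \<open>0 < \<mu>\<close> by (simp add: power_mult_distrib)
    then have n: "sqrt (2 * \<mu>) * s \<le> n"
      by (rule power2_le_imp_le) (simp add: n_def)
    then have "0 < n" using s \<open>0 < \<mu>\<close>
      by (smt (verit) mult_pos_pos real_sqrt_gt_zero)
    \<comment> \<open>The first bound keeps \<open>s - l * t * n\<close> nonnegative, so it may be
      squared; the second keeps \<open>1 - L * t / 2\<close> above \<open>\<theta>\<close>, which
      gives the contradiction.\<close>
    define t where "t = min (s / (l * n)) ((1 - \<theta>) / L)"
    have "0 < t" using s \<open>0 < l\<close> \<open>0 < n\<close> \<theta> \<open>0 < L\<close> by (simp add: t_def)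
    have t1: "l * t * n \<le> s"
    proof -
      have "t \<le> s / (l * n)" by (simp add: t_def)
      then show ?thesis using \<open>0 < l\<close> \<open>0 < n\<close> by (simp add: pos_le_divide_eq algebra_simps)
    qed
    have t2: "L * t \<le> 1 - \<theta>"
    proof -
      have "t \<le> (1 - \<theta>) / L" by (simp add: t_def)
      then show ?thesis using \<open>0 < L\<close> by (simp add: pos_le_divide_eq algebra_simps)
    qed
    define z where "z = y - t *\<^sub>R gradient f y"
    have "norm (z - x) \<le> norm (y - x) + t * n"
      using norm_triangle_ineq4[of "y - x" "t *\<^sub>R gradient f y"] \<open>0 < t\<close>
      by (simp add: z_def n_def algebra_simps)
    then have "l * norm (z - x) \<le> l * norm (y - x) + l * t * n"
      using mult_left_mono[of _ _ l] \<open>0 < l\<close> by (fastforce simp: algebra_simps)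
    then have "s - l * t * n \<le> sqrt (f z - f xs)"
      using glob[of z] by (simp add: \<phi>_def s_def)
    then have "(s - l * t * n)\<^sup>2 \<le> (sqrt (f z - f xs))\<^sup>2"
      using t1 by (intro power_mono) simp_all
    then have "(s - l * t * n)\<^sup>2 \<le> f z - f xs"
      using min[of z] by simp
    moreover have "s\<^sup>2 - 2 * s * (l * t * n) \<le> (s - l * t * n)\<^sup>2"
      by (simp add: power2_diff)
    moreover have "f z \<le> f y - t * (1 - L * t / 2) * n\<^sup>2"
      using LS_descent[OF \<open>f \<in> LS L\<close>] by (simp add: z_def n_def)
    ultimately have "t * (1 - L * t / 2) * n\<^sup>2 \<le> 2 * s * (l * t * n)"
      using s(2) by linarith
    then have "(t * n) * ((1 - L * t / 2) * n) \<le> (t * n) * (2 * s * l)"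
      by (simp add: algebra_simps power2_eq_square)
    then have "(1 - L * t / 2) * n \<le> 2 * s * l"
      using \<open>0 < t\<close> \<open>0 < n\<close> by simp
    also have "\<dots> = \<theta> * (sqrt (2 * \<mu>) * s)" by (simp add: l_def)
    also have "\<dots> \<le> \<theta> * n" using n \<theta> by simp
    finally have "1 - L * t / 2 \<le> \<theta>" using \<open>0 < n\<close> by simp
    then show False using t2 \<theta> by simp
  qed
  then have "y = xs" by (rule uniq)
  then show ?thesis
    using glob[of x] by (simp add: \<phi>_def l_def norm_minus_commute mult.assoc)
qed

text \<open>Let \<open>\<theta>\<close> tend to 1 in the previous bound and square it.\<close>

lemma PL_imp_QG_minus:
  assumes "continuous_on UNIV f" and "f \<in> LS L" and "0 < L" and "0 < \<mu>"
    and "f \<in> PL (f xs) \<mu>"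
    and min: "\<And>x. f xs \<le> f x" and "\<And>x. f x = f xs \<Longrightarrow> x = xs"
  shows "f \<in> QG_minus xs \<mu>"
  unfolding QG_minus_def
proof (intro CollectI allI)
  fix x
  have "sqrt (2 * \<mu>) / 2 * norm (x - xs) \<le> sqrt (f x - f xs)"
    using PL_imp_growth[OF assms] by (rule field_le_mult_one_interval)
  then have "(sqrt (2 * \<mu>) / 2 * norm (x - xs))\<^sup>2 \<le> (sqrt (f x - f xs))\<^sup>2"
    using \<open>0 < \<mu>\<close> by (intro power_mono) simp_all
  then show "\<mu> / 2 * (norm (x - xs))\<^sup>2 \<le> f x - f xs"
    using min[of x] \<open>0 < \<mu>\<close> by (simp add: power_mult_distrib power_divide)
qed

section \<open>The optimal growth constants\<close>

lemma QG_minus_le_QG_plus: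
  fixes f :: "'a::euclidean_space \<Rightarrow> real"
  assumes "f \<in> QG_minus xs m" and "f \<in> QG_plus xs M"
  shows "m \<le> M"
proof -
  obtain b :: 'a where b: "norm b = 1"
    using norm_Basis nonempty_Basis by blast
  have "m / 2 * (norm (xs + b - xs))\<^sup>2 \<le> M / 2 * (norm (xs + b - xs))\<^sup>2"
    using assms unfolding QG_minus_def QG_plus_def by (blast intro: order_trans)
  then show ?thesis by (simp add: b)
qed

text \<open>For \<open>x \<noteq> xs\<close> both growth conditions bound the ratio
  \<open>2 * (f x - f xs) / (norm (x - xs))\<^sup>2\<close>, so they pass to the supremum and the
  infimum of the constants.\<close>

lemma mu0_L0_properties:
  fixes f :: "'a::euclidean_space \<Rightarrow> real"
  assumes "0 < \<mu>" and "0 < L" and low: "f \<in> QG_minus xs \<mu>" and up: "f \<in> QG_plus xs L"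
  shows "f \<in> QG_minus xs (mu0 f xs \<mu>)" and "f \<in> QG_plus xs (L0 f xs L)"
    and "\<mu> \<le> mu0 f xs \<mu>" and "mu0 f xs \<mu> \<le> L0 f xs L" and "L0 f xs L \<le> L"
proof -
  let ?A = "{\<mu>'. 0 < \<mu>' \<and> \<mu> \<le> \<mu>' \<and> f \<in> QG_minus xs \<mu>'}"
  let ?B = "{L'. 0 < L' \<and> L' \<le> L \<and> f \<in> QG_plus xs L'}"
  have A: "\<mu> \<in> ?A" and B: "L \<in> ?B" using assms by simp_all
  have "bdd_above ?A" using QG_minus_le_QG_plus[OF _ up] by (intro bdd_aboveI) blast
  moreover have "bdd_below ?B" using QG_minus_le_QG_plus[OF low] by (intro bdd_belowI) blast
  ultimately show "\<mu> \<le> mu0 f xs \<mu>" and "L0 f xs L \<le> L"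
    unfolding mu0_def L0_def using A B by (auto intro: cSup_upper cInf_lower)
  show minus: "f \<in> QG_minus xs (mu0 f xs \<mu>)"
    unfolding QG_minus_def
  proof (intro CollectI allI)
    fix x
    show "mu0 f xs \<mu> / 2 * (norm (x - xs))\<^sup>2 \<le> f x - f xs"
    proof (cases "x = xs")
      case False
      have "mu0 f xs \<mu> \<le> 2 * (f x - f xs) / (norm (x - xs))\<^sup>2"
        unfolding mu0_def
      proof (rule cSup_least)
        fix m assume "m \<in> ?A"
        then have "m / 2 * (norm (x - xs))\<^sup>2 \<le> f x - f xs" by (simp add: QG_minus_def)
        then show "m \<le> 2 * (f x - f xs) / (norm (x - xs))\<^sup>2"
          using False by (simp add: pos_le_divide_eq)
      qed (use A in blast)
      then show ?thesis using False by (simp add: pos_le_divide_eq)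
    qed simp
  qed
  show plus: "f \<in> QG_plus xs (L0 f xs L)"
    unfolding QG_plus_def
  proof (intro CollectI allI)
    fix x
    show "f x - f xs \<le> L0 f xs L / 2 * (norm (x - xs))\<^sup>2"
    proof (cases "x = xs")
      case False
      have "2 * (f x - f xs) / (norm (x - xs))\<^sup>2 \<le> L0 f xs L"
        unfolding L0_def
      proof (rule cInf_greatest)
        fix m assume "m \<in> ?B"
        then have "f x - f xs \<le> m / 2 * (norm (x - xs))\<^sup>2" by (simp add: QG_plus_def)
        then show "2 * (f x - f xs) / (norm (x - xs))\<^sup>2 \<le> m"
          using False by (simp add: pos_divide_le_eq)
      qed (use B in blast)
      then show ?thesis using False by (simp add: pos_divide_le_eq)
    qed simp
  qed
  show "mu0 f xs \<mu> \<le> L0 f xs L" using minus plus by (rule QG_minus_le_QG_plus)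
qed

section \<open>One step of the Lyapunov function\<close>

lemma le_by_squares_mult:
  fixes x y :: real
  assumes "x\<^sup>2 \<le> y\<^sup>2" and "0 \<le> y" and "0 \<le> d"
  shows "x * d \<le> y * d"
  using assms power2_le_imp_le mult_right_mono by blast

lemma lyapunov_step:
  fixes f :: "'a::euclidean_space \<Rightarrow> real"
  assumes "0 < \<mu>" and "0 < L" and "0 < a"
    and "f \<in> LS L" and PL: "f \<in> PL (f xs) \<mu>" and AC: "f \<in> AC xs a"
    and low: "f \<in> QG_minus xs m" and up: "f \<in> QG_plus xs M"
    and "0 < m" and "m \<le> M" and "M \<le> L"
    and min: "f xs \<le> f x"
    and c_def: "c = sqrt (m * M) / 2"
    and x': "x' = x - (1 / L) *\<^sub>R gradient f x"
  shows "f x' - f xs + c * (norm (x' - xs))\<^sup>2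
    \<le> (1 - a * sqrt (\<mu> * m) / L) * (f x - f xs + c * (norm (x - xs))\<^sup>2)"
proof -
  define F where "F = f x - f xs"
  define d where "d = norm (x - xs)"
  define n where "n = norm (gradient f x)"
  define p where "p = inner (gradient f x) (x - xs)"
  have "0 < M" using \<open>0 < m\<close> \<open>m \<le> M\<close> by linarith
  have "0 < c" using \<open>0 < m\<close> \<open>0 < M\<close> by (simp add: c_def)
  have "0 \<le> F" "0 \<le> d" "0 \<le> n" using min by (simp_all add: F_def d_def n_def)
  have nF: "2 * \<mu> * F \<le> n\<^sup>2" using PL unfolding PL_def F_def n_def by blast
  have lowF: "m / 2 * d\<^sup>2 \<le> F" using low unfolding QG_minus_def F_def d_def by blast
  have upF: "F \<le> M / 2 * d\<^sup>2" using up unfolding QG_plus_def F_def d_def by blast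
  have p: "a * n * d \<le> p" using AC unfolding AC_def p_def n_def d_def by blast
  have "m * M \<le> L\<^sup>2"
    using mult_mono[of m L M L] assms by (simp add: power2_eq_square)
  then have "sqrt (m * M) \<le> L"
    using \<open>0 < L\<close> by (simp add: real_le_lsqrt)
  then have "c \<le> L / 2" by (simp add: c_def)

  have dist: "(norm (x' - xs))\<^sup>2 = d\<^sup>2 - 2 / L * p + n\<^sup>2 / L\<^sup>2"
  proof -
    have "x' - xs = (x - xs) - (1 / L) *\<^sub>R gradient f x" by (simp add: x')
    then show ?thesis
      by (simp only: d_def n_def p_def power2_norm_eq_inner)
        (simp add: inner_diff_left inner_diff_right inner_commute power2_eq_square algebra_simps)
  qed
  have "f x' - f xs \<le> F - n\<^sup>2 / (2 * L)"
    using LS_descent_step[OF \<open>f \<in> LS L\<close> \<open>0 < L\<close>, of x] by (simp add: x' F_def n_def)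
  moreover have "c * (norm (x' - xs))\<^sup>2 \<le> c * d\<^sup>2 - 2 * c / L * (a * n * d) + n\<^sup>2 / (2 * L)"
  proof -
    have "2 * c / L * (a * n * d) \<le> 2 * c / L * p"
      using p \<open>0 < c\<close> \<open>0 < L\<close> by (intro mult_left_mono) simp_all
    \<comment> \<open>The resulting \<open>n\<^sup>2 / (2 * L)\<close> is exactly the guaranteed
      decrease of \<open>f\<close>, so the two cancel in the sum.\<close>
    moreover have "c * (n\<^sup>2 / L\<^sup>2) \<le> L / 2 * (n\<^sup>2 / L\<^sup>2)"
      using \<open>c \<le> L / 2\<close> by (intro mult_right_mono) simp_all
    moreover have "L / 2 * (n\<^sup>2 / L\<^sup>2) = n\<^sup>2 / (2 * L)"
      using \<open>0 < L\<close> by (simp add: field_simps power2_eq_square)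
    ultimately show ?thesis unfolding dist by (simp add: algebra_simps)
  qed
  ultimately have decr: "f x' - f xs + c * (norm (x' - xs))\<^sup>2
      \<le> F + c * d\<^sup>2 - 2 * a / L * (c * (n * d))"
    by (simp add: algebra_simps)

  have "sqrt (\<mu> * m) * d\<^sup>2 \<le> n * d"
  proof -
    have "\<mu> * (m / 2 * d\<^sup>2) \<le> \<mu> * F"
      using lowF \<open>0 < \<mu>\<close> by (intro mult_left_mono) simp_all
    then have "\<mu> * m * d\<^sup>2 \<le> n\<^sup>2"
      using nF by linarith
    then have "(sqrt (\<mu> * m) * d)\<^sup>2 \<le> n\<^sup>2"
      using \<open>0 < \<mu>\<close> \<open>0 < m\<close> by (simp add: power_mult_distrib)
    from le_by_squares_mult[OF this \<open>0 \<le> n\<close> \<open>0 \<le> d\<close>]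
    show ?thesis by (simp add: power2_eq_square mult.assoc)
  qed
  then have 1: "sqrt (\<mu> * m) * (c * d\<^sup>2) \<le> c * (n * d)"
    using mult_left_mono[of _ _ c] \<open>0 < c\<close> by (fastforce simp: algebra_simps)
  \<comment> \<open>Multiplying \<open>nF\<close> by \<open>upF\<close> bounds
    \<open>F\<^sup>2\<close> by a multiple of \<open>(n * d)\<^sup>2\<close>; the constants match
    because \<open>c\<^sup>2 = m * M / 4\<close>.\<close>
  have 2: "sqrt (\<mu> * m) * F \<le> c * (n * d)"
  proof (rule power2_le_imp_le)
    have "(2 * \<mu> * F) * F \<le> n\<^sup>2 * (M / 2 * d\<^sup>2)"
      using nF upF \<open>0 \<le> F\<close> \<open>0 < \<mu>\<close> by (intro mult_mono) simp_all
    then have "m / 2 * ((2 * \<mu> * F) * F) \<le> m / 2 * (n\<^sup>2 * (M / 2 * d\<^sup>2))"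
      using \<open>0 < m\<close> by (intro mult_left_mono) simp_all
    then show "(sqrt (\<mu> * m) * F)\<^sup>2 \<le> (c * (n * d))\<^sup>2"
      using \<open>0 < \<mu>\<close> \<open>0 < m\<close> \<open>0 < M\<close>
      by (simp add: c_def power_mult_distrib power_divide) (simp add: power2_eq_square algebra_simps)
    show "0 \<le> c * (n * d)" using \<open>0 < c\<close> \<open>0 \<le> n\<close> \<open>0 \<le> d\<close> by simp
  qed
  have "a / L * (sqrt (\<mu> * m) * (F + c * d\<^sup>2)) \<le> a / L * (2 * (c * (n * d)))"
    using 1 2 \<open>0 < a\<close> \<open>0 < L\<close> by (intro mult_left_mono) (simp_all add: algebra_simps)
  with decr show ?thesis by (simp add: F_def d_def algebra_simps)
qed

section \<open>Convergence rates of gradient descent\<close>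

theorem theorem5p2:
  fixes f :: "real ^ 'd \<Rightarrow> real"
    and xt :: "nat \<Rightarrow> real ^ 'd"
    and \<mu> L a fstar :: real
  assumes "\<mu> > 0" and "L > 0" and "0 < a" and "a \<le> 1"
    and "continuously_differentiable f"
    and "fstar \<in> range f" and "\<And>x. fstar \<le> f x"
    and "f \<in> LS L"
    and "\<And>k. xt (Suc k) = xt k - (1 / L) *\<^sub>R gradient f (xt k)"
  shows "(f \<in> PL fstar \<mu> \<longrightarrow>
            (\<forall>k. f (xt k) - fstar \<le> (1 - \<mu> / L) ^ k * (f (xt 0) - fstar)))
       \<and> (\<forall>xstar. (\<forall>x. f x = fstar \<longleftrightarrow> x = xstar) \<and> f \<in> PL fstar \<mu> \<inter> AC xstar a \<longrightarrow>
            (\<forall>k. f (xt k) - fstar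
                 \<le> K0 f xstar \<mu> L * (1 - a * sqrt (\<mu> * mu0 f xstar \<mu>) / L) ^ k
                    * (f (xt 0) - fstar)))"
proof (intro conjI impI allI)
  fix k
  assume PL: "f \<in> PL fstar \<mu>"
  show "f (xt k) - fstar \<le> (1 - \<mu> / L) ^ k * (f (xt 0) - fstar)"
  proof (rule geometric_decay)
    fix k
    have "2 * \<mu> * (f (xt k) - fstar) \<le> (norm (gradient f (xt k)))\<^sup>2"
      using PL unfolding PL_def by blast
    then have "2 * \<mu> * (f (xt k) - fstar) / (2 * L) \<le> (norm (gradient f (xt k)))\<^sup>2 / (2 * L)"
      using \<open>L > 0\<close> by (intro divide_right_mono) simp_all
    then have "\<mu> / L * (f (xt k) - fstar) \<le> (norm (gradient f (xt k)))\<^sup>2 / (2 * L)"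
      by simp
    then show "f (xt (Suc k)) - fstar \<le> (1 - \<mu> / L) * (f (xt k) - fstar)"
      using LS_descent_step[OF \<open>f \<in> LS L\<close> \<open>L > 0\<close>, of "xt k", folded assms(9)]
      by (simp add: algebra_simps)
  qed (use assms(7) in simp)
next
  fix xs k
  assume *: "(\<forall>x. f x = fstar \<longleftrightarrow> x = xs) \<and> f \<in> PL fstar \<mu> \<inter> AC xs a"
  then have fs: "fstar = f xs" by metis
  have PL: "f \<in> PL (f xs) \<mu>" and AC: "f \<in> AC xs a" using * fs by simp_all
  have min: "f xs \<le> f x" for x using assms(7) fs by simp
  define m where "m = mu0 f xs \<mu>"
  define M where "M = L0 f xs L"
  define c where "c = sqrt (m * M) / 2"
  define E where "E = (\<lambda>k. f (xt k) - f xs + c * (norm (xt k - xs))\<^sup>2)"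
  define q where "q = 1 - a * sqrt (\<mu> * m) / L"
  have low: "f \<in> QG_minus xs \<mu>"
    using continuously_differentiable_imp_continuous_on[OF assms(5)] assms(8,2,1) PL min
    by (rule PL_imp_QG_minus) (use * fs in metis)
  have up: "f \<in> QG_plus xs L"
    using \<open>f \<in> LS L\<close> \<open>L > 0\<close> min by (rule LS_imp_QG_plus)
  \<comment> \<open>From here on \<open>m\<close> and \<open>M\<close> are the optimal constants,
    themselves admissible in the growth conditions.\<close>
  note props = mu0_L0_properties[OF \<open>\<mu> > 0\<close> \<open>L > 0\<close> low up, folded m_def M_def]
  have "0 < m" "0 < M" using props \<open>\<mu> > 0\<close> by linarith+
  then have "0 < c" by (simp add: c_def)
  have decay: "E k \<le> q ^ k * E 0"
  proof (rule geometric_decay)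
    show "0 \<le> E k" for k using min[of "xt k"] \<open>0 < c\<close> by (simp add: E_def)
    show "E (Suc k) \<le> q * E k" for k
      unfolding E_def q_def
      using assms(1-3,8) PL AC props(1,2) \<open>0 < m\<close> props(4,5) min c_def assms(9)
      by (rule lyapunov_step)
  qed
  \<comment> \<open>Needed to multiply the bound on \<open>E 0\<close> by \<open>q ^ k\<close>; it
    follows from \<open>m \<le> M \<le> L\<close>, \<open>\<mu> \<le> m\<close> and
    \<open>a \<le> 1\<close>.\<close>
  have "0 \<le> q"
  proof -
    have "\<mu> * m \<le> L\<^sup>2"
      unfolding power2_eq_square using props \<open>\<mu> > 0\<close> \<open>L > 0\<close> by (intro mult_mono) simp_all
    then have "sqrt (\<mu> * m) \<le> L" using \<open>L > 0\<close> by (simp add: real_le_lsqrt)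
    then have "a * sqrt (\<mu> * m) \<le> 1 * L"
      using assms(1-4) \<open>0 < m\<close> by (intro mult_mono) simp_all
    then show ?thesis using \<open>L > 0\<close> by (simp add: q_def)
  qed
  have "E 0 \<le> K0 f xs \<mu> L * (f (xt 0) - fstar)"
  proof -
    \<comment> \<open>In this form lower growth bounds the distance term by
      \<open>sqrt (M / m)\<close> times the initial gap; adding the gap itself gives
      \<open>K0\<close>.\<close>
    have "c = sqrt (M / m) * (m / 2)"
      using \<open>0 < m\<close> by (simp add: c_def real_sqrt_mult real_sqrt_divide real_div_sqrt field_simps)
    then have "c * (norm (xt 0 - xs))\<^sup>2 = sqrt (M / m) * (m / 2 * (norm (xt 0 - xs))\<^sup>2)"
      by simp
    also have "\<dots> \<le> sqrt (M / m) * (f (xt 0) - f xs)"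
      using props(1) \<open>0 < m\<close> \<open>0 < M\<close> unfolding QG_minus_def by (intro mult_left_mono) auto
    finally show ?thesis
      by (simp add: E_def K0_def fs m_def M_def algebra_simps)
  qed
  then have "q ^ k * E 0 \<le> q ^ k * (K0 f xs \<mu> L * (f (xt 0) - fstar))"
    using \<open>0 \<le> q\<close> by (intro mult_left_mono) simp_all
  moreover have "f (xt k) - fstar \<le> E k" using \<open>0 < c\<close> by (simp add: E_def fs)
  ultimately show "f (xt k) - fstar
      \<le> K0 f xs \<mu> L * (1 - a * sqrt (\<mu> * mu0 f xs \<mu>) / L) ^ k * (f (xt 0) - fstar)"
    using decay by (simp add: q_def m_def algebra_simps)
qed

end
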